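(* Let $d \geq 2$ and $n \geq 3$ be integers. Consider the $d$-objective maximum spanning tree problem on the complete graph $K_n$: each edge $e$ of $K_n$ carries $d$ profits $v^{(1)}(e), \dots, v^{(d)}(e)$, and each spanning tree $T$ has profits $v^{(i)}(T) = \sum_{e \in T} v^{(i)}(e)$, $i \in [d]$. Then there exists a choice of $4$-semirandom distributions for the profits $v^{(i)}(e)$ (chosen independently over all edges $e$ and all $i \in [d]$) such that the expected number of Pareto-optimal spanning trees is at least \[ \left(\frac{n-3}{2(d-1)}\right)^{d-1}. \]
   Context: A $\phi$-semirandom distribution is a probability distribution supported on $[-1,1]$ having a probability density bounded above by $\phi$. A spanning tree $T$ is Pareto-optimal if there is no spanning tree $T'$ with $v^{(i)}(T') \geq v^{(i)}(T)$ for all $i \in [d]$ and strict inequality for at least one $i$ (all profits are to be maximized). *)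

theory Defs
  imports "HOL-Probability.Probability"
begin

text \<open>Vertices of K_n are 0..n-1; edges are the 2-element subsets.\<close>
definition Kn_edges :: "nat \<Rightarrow> nat set set" where
  "Kn_edges n = {e. \<exists>u v. u < n \<and> v < n \<and> u \<noteq> v \<and> e = {u, v}}"

definition adj :: "nat set set \<Rightarrow> (nat \<times> nat) set" where
  "adj T = {(u, v). {u, v} \<in> T \<and> u \<noteq> v}"

definition connected_on :: "nat \<Rightarrow> nat set set \<Rightarrow> bool" where
  "connected_on n T \<longleftrightarrow> (\<forall>u<n. \<forall>v<n. (u, v) \<in> (adj T)\<^sup>*)"

text \<open>Spanning tree of K_n: a connected spanning subgraph that is acyclic,
  i.e. minimally connected (removing any edge disconnects it).\<close>
definition spanning_tree :: "nat \<Rightarrow> nat set set \<Rightarrow> bool" where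
  "spanning_tree n T \<longleftrightarrow> T \<subseteq> Kn_edges n \<and> connected_on n T \<and>
     (\<forall>e\<in>T. \<not> connected_on n (T - {e}))"

definition tree_profit :: "((nat \<times> nat set) \<Rightarrow> real) \<Rightarrow> nat \<Rightarrow> nat set set \<Rightarrow> real" where
  "tree_profit v i T = (\<Sum>e\<in>T. v (i, e))"

definition pareto_optimal ::
  "nat \<Rightarrow> nat \<Rightarrow> ((nat \<times> nat set) \<Rightarrow> real) \<Rightarrow> nat set set \<Rightarrow> bool" where
  "pareto_optimal d n v T \<longleftrightarrow> spanning_tree n T \<and>
     \<not> (\<exists>T'. spanning_tree n T' \<and> (\<forall>i<d. tree_profit v i T' \<ge> tree_profit v i T)
              \<and> (\<exists>i<d. tree_profit v i T' > tree_profit v i T))"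

definition num_pareto :: "nat \<Rightarrow> nat \<Rightarrow> ((nat \<times> nat set) \<Rightarrow> real) \<Rightarrow> nat" where
  "num_pareto d n v = card {T. pareto_optimal d n v T}"

text \<open>A phi-semirandom distribution: a probability distribution on the reals,
  supported on [-1,1], having a probability density bounded above by phi.\<close>
definition semirandom :: "real \<Rightarrow> real measure \<Rightarrow> bool" where
  "semirandom \<phi> \<mu> \<longleftrightarrow> prob_space \<mu> \<and> sets \<mu> = sets borel \<and> emeasure \<mu> {-1..1} = 1 \<and>
     (\<exists>f. f \<in> borel_measurable borel \<and> (\<forall>x. 0 \<le> f x \<and> f x \<le> \<phi>) \<and> \<mu> = density lborel f)"

end

theory Submission
  imports "Jordan_Normal_Form.Determinant" Defs
begin

text \<open>
  Let the edge \<open>{0, 1}\<close> have profits in \<open>[3/4, 1]\<close>, the edges \<open>{0, w}\<close> and \<open>{1, w}\<close> with \<open>w \<ge> 2\<close>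
  profits in \<open>[0, 1/4]\<close>, and all other edges profits in \<open>[-1, -3/4]\<close>, all uniform. For positive
  weights \<open>\<lambda>\<close>, a maximum spanning tree of the \<open>\<lambda>\<close>-weighted profit consists of \<open>{0, 1}\<close> and the
  better one of \<open>{0, w}\<close> and \<open>{1, w}\<close> for each \<open>w\<close>, so it encodes the sign vector at \<open>\<lambda>\<close> of the
  \<open>n - 2\<close> linear forms \<open>\<Sum>i. \<lambda> i * a i w\<close>, where \<open>a i w\<close> is the difference of the profits of
  \<open>{0, w}\<close> and \<open>{1, w}\<close> in objective \<open>i\<close>, and it is Pareto-optimal.

  Exchanging the vertices \<open>0\<close> and \<open>1\<close> in the objectives \<open>i \<in> g\<close> preserves the distribution and flips
  the signs of \<open>a i w\<close> for \<open>i \<in> g\<close>, which replaces the positive orthant by another one. Hence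
  \<open>2 ^ (d - 1)\<close> times the expected number of Pareto-optimal trees is at least the expected number
  of sign vectors of the \<open>n - 2\<close> forms over all \<open>\<lambda>\<close> with \<open>\<lambda> 0 = 1\<close> and no zero coordinate.
  Almost surely these are affine hyperplanes in general position in dimension \<open>d - 1\<close>. Any \<open>d - 1\<close> of
  them meet in a vertex around which all their signs occur while the other signs are constant, that
  is, the family of sign vectors strongly shatters every set of \<open>d - 1\<close> indices, so it has at least
  \<open>(n - 2) choose (d - 1)\<close> members.
\<close>

section \<open>Strong shattering\<close>

text \<open>In the cube of subsets, \<open>F\<close> contains a full subcube with free directions
  \<open>S\<close>, and \<open>B\<close> is the constant pattern of that subcube off
  \<open>S\<close>.\<close>

definition strongly_shatters :: "'a set set \<Rightarrow> 'a set \<Rightarrow> bool" where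
  "strongly_shatters F S \<longleftrightarrow> (\<exists>B. B \<inter> S = {} \<and> (\<forall>Q\<subseteq>S. B \<union> Q \<in> F))"

text \<open>Ordinary shattering would not do: a family has at least as many shattered sets as members,
  while the strongly shattered sets are at most as many.\<close>

lemma strongly_shattersI:
  "B \<inter> S = {} \<Longrightarrow> (\<And>Q. Q \<subseteq> S \<Longrightarrow> B \<union> Q \<in> F) \<Longrightarrow> strongly_shatters F S"
  unfolding strongly_shatters_def by blast

text \<open>Lower half of the sandwich theorem for shattering, by induction on the ground set.
  Strongly shattered sets avoiding \<open>x\<close> survive in the projection \<open>F1\<close>;
  those containing \<open>x\<close> yield, after dropping \<open>x\<close>, sets strongly shattered
  by \<open>F2\<close>.\<close>

lemma card_strongly_shattered_le:
  assumes "finite X" "F \<subseteq> Pow X"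
  shows "card {S. S \<subseteq> X \<and> strongly_shatters F S} \<le> card F"
  using assms
proof (induction X arbitrary: F rule: finite_induct)
  case empty
  show ?case
  proof (cases "F = {}")
    case True
    then show ?thesis by (simp add: strongly_shatters_def)
  next
    case False
    with empty have "F = {{}}" by auto
    moreover have "card {S. S \<subseteq> {} \<and> strongly_shatters F S} \<le> card {{}::'a set}"
      by (rule card_mono) auto
    ultimately show ?thesis by simp
  qed
next
  case (insert x X)
  define F1 where "F1 = (\<lambda>P. P - {x}) ` F"
  define F2 where "F2 = {P. x \<notin> P \<and> P \<in> F \<and> insert x P \<in> F}"
  let ?sh = "\<lambda>X F. {S. S \<subseteq> X \<and> strongly_shatters F S}"
  have finF: "finite F"
    using insert by (meson finite_Pow_iff finite_insert finite_subset)
  have sub1: "F1 \<subseteq> Pow X" and sub2: "F2 \<subseteq> Pow X"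
    using insert.prems unfolding F1_def F2_def by auto
  \<comment> \<open>Removing \<open>x\<close> from the members that contain it gives
    \<open>?B'\<close>. Then \<open>?A\<close> and \<open>?B'\<close> have union \<open>F1\<close>
    and intersection \<open>F2\<close>, so inclusion-exclusion applies.\<close>
  have card_F: "card F = card F1 + card F2"
  proof -
    let ?A = "{P\<in>F. x \<notin> P}" and ?B = "{P\<in>F. x \<in> P}"
    let ?B' = "(\<lambda>P. P - {x}) ` ?B"
    have "inj_on (\<lambda>P. P - {x}) ?B"
      by (rule inj_onI) (metis (mono_tags, lifting) insert_Diff mem_Collect_eq)
    then have B: "card ?B' = card ?B" by (rule card_image)
    have AB: "F = ?A \<union> ?B" "?A \<inter> ?B = {}" by auto
    have "card F = card ?A + card ?B"
      by (subst AB(1), rule card_Un_disjoint) (use finF in auto)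
    also have "\<dots> = card (?A \<union> ?B') + card (?A \<inter> ?B')"
      using B card_Un_Int[of ?A ?B'] finF by simp
    also have "?A \<union> ?B' = F1"
    proof -
      have "(\<lambda>P. P - {x}) ` ?A = ?A" by (force simp: image_iff)
      then show ?thesis unfolding F1_def by (subst (2) AB(1)) (simp only: image_Un)
    qed
    also have "?A \<inter> ?B' = F2"
      unfolding F2_def by (auto simp: image_iff insert_absorb)
    finally show ?thesis .
  qed
  have *: "strongly_shatters F1 S" if S: "S \<subseteq> X" "strongly_shatters F S" for S
  proof -
    have xS: "x \<notin> S" using S insert.hyps by auto
    obtain B where B: "B \<inter> S = {}" "\<And>Q. Q \<subseteq> S \<Longrightarrow> B \<union> Q \<in> F"
      using S unfolding strongly_shatters_def by blast
    have "(B - {x}) \<union> Q \<in> F1" if "Q \<subseteq> S" for Q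
    proof -
      have "(B - {x}) \<union> Q = (B \<union> Q) - {x}" using that xS by auto
      then show ?thesis unfolding F1_def using B(2)[OF that] by auto
    qed
    then show ?thesis using B(1) by (intro strongly_shattersI[of "B - {x}"]) auto
  qed
  moreover have "strongly_shatters F2 (S - {x})" if S: "x \<in> S" "strongly_shatters F S" for S
  proof -
    obtain B where B: "B \<inter> S = {}" "\<And>Q. Q \<subseteq> S \<Longrightarrow> B \<union> Q \<in> F"
      using S unfolding strongly_shatters_def by blast
    have "B \<union> Q \<in> F2" if "Q \<subseteq> S - {x}" for Q
      using B(1) B(2)[of Q] B(2)[of "insert x Q"] S that unfolding F2_def by auto
    then show ?thesis using B(1) by (intro strongly_shattersI[of B]) auto
  qed
  ultimately have "?sh (insert x X) F \<subseteq> ?sh X F1 \<union> insert x ` ?sh X F2"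
  proof (intro subsetI)
    fix S assume *: "S \<in> ?sh (insert x X) F"
    show "S \<in> ?sh X F1 \<union> insert x ` ?sh X F2"
    proof (cases "x \<in> S")
      case True
      then have "S = insert x (S - {x})" "S - {x} \<in> ?sh X F2"
        using * \<open>\<And>S. x \<in> S \<Longrightarrow> strongly_shatters F S \<Longrightarrow> strongly_shatters F2 (S - {x})\<close>
        by blast+
      then show ?thesis by (metis UnI2 imageI)
    next
      case False
      then show ?thesis
        using * \<open>\<And>S. S \<subseteq> X \<Longrightarrow> strongly_shatters F S \<Longrightarrow> strongly_shatters F1 S\<close> by blast
    qed
  qed
  then have "card (?sh (insert x X) F) \<le> card (?sh X F1 \<union> insert x ` ?sh X F2)"
    using insert.hyps by (intro card_mono) auto
  also have "\<dots> \<le> card (?sh X F1) + card (insert x ` ?sh X F2)"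
    by (rule card_Un_le)
  also have "card (insert x ` ?sh X F2) \<le> card (?sh X F2)"
    using insert.hyps by (intro card_image_le) auto
  finally show ?case
    using insert.IH[OF sub1] insert.IH[OF sub2] card_F by simp
qed

section \<open>Spanning trees\<close>

lemma finite_Kn_edges: "finite (Kn_edges n)"
  by (rule finite_subset[of _ "Pow {..<n}"]) (auto simp: Kn_edges_def)

lemma Kn_edgesI: "u < n \<Longrightarrow> v < n \<Longrightarrow> u \<noteq> v \<Longrightarrow> {u, v} \<in> Kn_edges n"
  by (auto simp: Kn_edges_def)

lemma finite_spanning_trees: "finite {T. spanning_tree n T}"
  by (rule finite_subset[of _ "Pow (Kn_edges n)"]) (auto simp: spanning_tree_def finite_Kn_edges)

lemma sym_adj: "sym (adj T)"
  by (auto simp: sym_def adj_def insert_commute)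

lemma adj_mono: "T \<subseteq> T' \<Longrightarrow> adj T \<subseteq> adj T'"
  by (auto simp: adj_def)

text \<open>Cut a path at its first arrival at \<open>w\<close>; the part before it uses no edge at
  \<open>w\<close>. The induction invariant is that either \<open>w\<close> has not been visited yet
  or the cut has already been found.\<close>

lemma rtrancl_adj_last_edge:
  assumes "(u, w) \<in> (adj T)\<^sup>*" "u \<noteq> w"
  shows "\<exists>x. (u, x) \<in> (adj {e\<in>T. w \<notin> e})\<^sup>* \<and> (x, w) \<in> adj T"
proof -
  have "(y \<noteq> w \<and> (u, y) \<in> (adj {e\<in>T. w \<notin> e})\<^sup>*) \<or>
        (\<exists>x. (u, x) \<in> (adj {e\<in>T. w \<notin> e})\<^sup>* \<and> (x, w) \<in> adj T)"
    if "(u, y) \<in> (adj T)\<^sup>*" for y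
    using that
  proof (induction rule: rtrancl_induct)
    case base
    then show ?case using assms by auto
  next
    case (step y z)
    show ?case
    proof (cases "y \<noteq> w \<and> (u, y) \<in> (adj {e\<in>T. w \<notin> e})\<^sup>* \<and> z \<noteq> w")
      case True
      then have "(y, z) \<in> adj {e\<in>T. w \<notin> e}"
        using step by (auto simp: adj_def)
      then show ?thesis using True by (meson rtrancl.rtrancl_into_rtrancl)
    next
      case False
      then show ?thesis using step by blast
    qed
  qed
  then show ?thesis using assms by blast
qed

text \<open>\<open>\<phi> e\<close> is the endpoint of \<open>e\<close> that removing \<open>e\<close> separates from the root \<open>0\<close>.\<close>

lemma spanning_tree_child_map:
  assumes T: "spanning_tree n T" and n: "0 < n"
  obtains \<phi> where "inj_on \<phi> T" "\<And>e. e \<in> T \<Longrightarrow> \<phi> e \<in> e" "\<And>e. e \<in> T \<Longrightarrow> \<phi> e \<in> {0<..<n}"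
proof -
  have T': "T \<subseteq> Kn_edges n" "connected_on n T" "\<And>e. e \<in> T \<Longrightarrow> \<not> connected_on n (T - {e})"
    using T by (auto simp: spanning_tree_def)
  \<comment> \<open>If both endpoints of \<open>e\<close> stayed reachable from the root, every use
    of \<open>e\<close> on a path could be bypassed, and \<open>T - {e}\<close> would be
    connected.\<close>
  have ex: "\<exists>w\<in>e. w < n \<and> (0, w) \<notin> (adj (T - {e}))\<^sup>*" if e: "e \<in> T" for e
  proof (rule ccontr)
    assume "\<not> ?thesis"
    then have reach: "(0, w) \<in> (adj (T - {e}))\<^sup>*" if "w \<in> e" "w < n" for w using that by auto
    obtain u v where uv: "e = {u, v}" "u < n" "v < n"
      using e T' by (auto simp: Kn_edges_def)
    have "(0, y) \<in> (adj (T - {e}))\<^sup>*" if "(0, y) \<in> (adj T)\<^sup>*" for y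
      using that
    proof (induction rule: rtrancl_induct)
      case (step y z)
      show ?case
      proof (cases "{y, z} = e")
        case True
        then have "z \<in> e" by auto
        then show ?thesis using reach uv by blast
      next
        case False
        then have "(y, z) \<in> adj (T - {e})" using step by (auto simp: adj_def)
        then show ?thesis using step by (meson rtrancl.rtrancl_into_rtrancl)
      qed
    qed auto
    then have "(0, y) \<in> (adj (T - {e}))\<^sup>*" if "y < n" for y
      using T' n that by (auto simp: connected_on_def)
    moreover have "sym ((adj (T - {e}))\<^sup>*)" by (intro sym_rtrancl sym_adj)
    ultimately have "connected_on n (T - {e})"
      unfolding connected_on_def by (meson rtrancl_trans symD)
    then show False using T' e by auto
  qed
  define \<phi> where "\<phi> = (\<lambda>e. SOME w. w \<in> e \<and> w < n \<and> (0, w) \<notin> (adj (T - {e}))\<^sup>*)"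
  have \<phi>: "\<phi> e \<in> e" "\<phi> e < n" "(0, \<phi> e) \<notin> (adj (T - {e}))\<^sup>*" if "e \<in> T" for e
    using someI_ex[of "\<lambda>w. w \<in> e \<and> w < n \<and> (0, w) \<notin> (adj (T - {e}))\<^sup>*"] ex[OF that]
    unfolding \<phi>_def by blast+
  have nz: "\<phi> e \<noteq> 0" if "e \<in> T" for e
    using \<phi>(3)[OF that] by (metis rtrancl.rtrancl_refl)
  show thesis
  proof (rule that[of \<phi>])
    show "inj_on \<phi> T"
    proof (rule inj_onI, rule ccontr)
      fix e e' assume ee: "e \<in> T" "e' \<in> T" "\<phi> e = \<phi> e'" "e \<noteq> e'"
      define w where "w = \<phi> e"
      have w: "0 \<noteq> w" "w < n" "w \<in> e" "w \<in> e'" "(0, w) \<notin> (adj (T - {e}))\<^sup>*"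
        "(0, w) \<notin> (adj (T - {e'}))\<^sup>*"
        using nz \<phi> ee unfolding w_def by (metis)+
      obtain x where x: "(0, x) \<in> (adj {e\<in>T. w \<notin> e})\<^sup>*" "(x, w) \<in> adj T"
        using rtrancl_adj_last_edge[of 0 w T] w T' n by (auto simp: connected_on_def)
      \<comment> \<open>The path found enters \<open>w\<close> through \<open>{x, w}\<close> and
        uses no other edge at \<open>w\<close>, so it survives the deletion of any other edge
        \<open>f\<close> at \<open>w\<close>. Since \<open>{x, w}\<close> differs from
        \<open>e\<close> or from \<open>e'\<close>, one of these does not separate \<open>w\<close>
        from the root.\<close>
      have "(0, w) \<in> (adj (T - {f}))\<^sup>*" if f: "w \<in> f" "{x, w} \<noteq> f" for f
      proof -
        have "(0, x) \<in> (adj (T - {f}))\<^sup>*"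
          using x(1) rtrancl_mono[OF adj_mono, of "{e\<in>T. w \<notin> e}" "T - {f}"] f by auto
        moreover have "(x, w) \<in> adj (T - {f})" using x(2) f by (auto simp: adj_def)
        ultimately show ?thesis by (meson rtrancl.rtrancl_into_rtrancl)
      qed
      then show False using w ee by metis
    qed
  qed (use \<phi> nz in auto)
qed

section \<open>Double stars with centres 0 and 1\<close>

definition star_edge :: "nat set \<Rightarrow> nat \<Rightarrow> nat set" where
  "star_edge P w = {if w \<in> P then 0 else 1, w}"

definition double_star :: "nat \<Rightarrow> nat set \<Rightarrow> nat set set" where
  "double_star n P = insert {0, 1} (star_edge P ` {2..<n})"

lemma rtrancl_adj_closed:
  assumes "(u, v) \<in> (adj T)\<^sup>*" "u \<in> A" "\<And>x y. x \<in> A \<Longrightarrow> (x, y) \<in> adj T \<Longrightarrow> y \<in> A"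
  shows "v \<in> A"
  using assms(1,2) by (induction rule: rtrancl_induct) (use assms(3) in auto)

lemma star_edge_neq: "w \<in> {2..<n} \<Longrightarrow> star_edge P w \<noteq> {0, 1}"
  by (auto simp: star_edge_def doubleton_eq_iff)

lemma inj_star_edge: "inj_on (star_edge P) {2..<n}"
  by (auto simp: inj_on_def star_edge_def doubleton_eq_iff split: if_splits)

lemma spanning_tree_double_star:
  assumes n: "2 \<le> n"
  shows "spanning_tree n (double_star n P)"
proof -
  let ?T = "double_star n P"
  have sub: "?T \<subseteq> Kn_edges n"
    using n by (auto simp: double_star_def star_edge_def split: if_splits intro!: Kn_edgesI)
  have 01: "(0, 1) \<in> adj ?T" "(1, 0) \<in> adj ?T"
    by (auto simp: adj_def double_star_def insert_commute)
  have "(0, w) \<in> (adj ?T)\<^sup>*" if "w < n" for w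
  proof (cases "w < 2")
    case True
    then have "w = 0 \<or> w = 1" by auto
    then show ?thesis using 01 by auto
  next
    case False
    then have "star_edge P w \<in> ?T" using that by (auto simp: double_star_def)
    then have "(if w \<in> P then 0 else 1, w) \<in> adj ?T"
      using False by (auto simp: star_edge_def adj_def)
    then show ?thesis using 01
      by (cases "w \<in> P") (auto intro: rtrancl_trans)
  qed
  moreover have "sym ((adj ?T)\<^sup>*)" by (intro sym_rtrancl sym_adj)
  ultimately have con: "connected_on n ?T"
    unfolding connected_on_def by (meson rtrancl_trans symD)
  have "\<not> connected_on n (?T - {e})" if e: "e \<in> ?T" for e
  proof
    assume con: "connected_on n (?T - {e})"
    consider "e = {0, 1}" | w where "w \<in> {2..<n}" "e = star_edge P w"
      using e by (auto simp: double_star_def)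
    then show False
    proof cases
      case 1
      have "(0, 1) \<in> (adj (?T - {e}))\<^sup>*" using con n by (auto simp: connected_on_def)
      \<comment> \<open>Without \<open>{0, 1}\<close>, the vertex 0 together with its leaves is
        closed under adjacency.\<close>
      then have "1 \<in> insert 0 (P \<inter> {2..<n})"
        by (rule rtrancl_adj_closed)
          (auto simp: adj_def 1 double_star_def star_edge_def doubleton_eq_iff split: if_splits)
      then show False by auto
    next
      case 2
      have "(w, 0) \<in> (adj (?T - {e}))\<^sup>*" using con n 2 by (auto simp: connected_on_def)
      \<comment> \<open>The vertex \<open>w\<close> is a leaf, hence isolated once its edge is
        gone.\<close>
      then have "0 \<in> {w}"
        by (rule rtrancl_adj_closed)
          (use 2 in \<open>auto simp: adj_def double_star_def star_edge_def doubleton_eq_iff split: if_splits\<close>)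
      then show False using 2 by auto
    qed
  qed
  then show ?thesis using sub con by (auto simp: spanning_tree_def)
qed

lemma inj_on_double_star: "inj_on (double_star n) (Pow {2..<n})"
proof (rule inj_onI)
  have *: "P = {w\<in>{2..<n}. {0, w} \<in> double_star n P}" if "P \<subseteq> {2..<n}" for P
    using that by (auto simp: double_star_def star_edge_def doubleton_eq_iff image_iff split: if_splits)
  fix P Q assume "P \<in> Pow {2..<n}" "Q \<in> Pow {2..<n}" "double_star n P = double_star n Q"
  then show "P = Q" using *[of P] *[of Q] by auto
qed

text \<open>Each edge \<open>e\<close> of \<open>T\<close> is charged to its child endpoint
  \<open>\<phi> e\<close>, whose budget \<open>b\<close> is the weight of the double star edge above
  that vertex. Children are distinct and budgets are nonnegative, so the total is at most the sum of
  all budgets, which is the weight of the double star.\<close>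

lemma double_star_max_weight:
  fixes c :: "nat set \<Rightarrow> real"
  assumes n: "2 \<le> n" and T: "spanning_tree n T"
    and top: "\<And>e. e \<in> Kn_edges n \<Longrightarrow> c e \<le> c {0, 1}" "0 \<le> c {0, 1}"
    and star: "\<And>w. w \<in> {2..<n} \<Longrightarrow> 0 \<le> c {0, w}" "\<And>w. w \<in> {2..<n} \<Longrightarrow> 0 \<le> c {1, w}"
    and other: "\<And>e. e \<in> Kn_edges n \<Longrightarrow> 0 \<notin> e \<Longrightarrow> 1 \<notin> e \<Longrightarrow> c e \<le> 0"
    and P: "\<And>w. w \<in> P \<Longrightarrow> w \<in> {2..<n} \<Longrightarrow> c {1, w} \<le> c {0, w}"
      "\<And>w. w \<notin> P \<Longrightarrow> w \<in> {2..<n} \<Longrightarrow> c {0, w} \<le> c {1, w}"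
  shows "sum c T \<le> sum c (double_star n P)"
proof -
  obtain \<phi> where \<phi>: "inj_on \<phi> T" "\<And>e. e \<in> T \<Longrightarrow> \<phi> e \<in> e" "\<And>e. e \<in> T \<Longrightarrow> \<phi> e \<in> {0<..<n}"
    using spanning_tree_child_map[OF T] n by auto
  define b where "b w = (if w = 1 then c {0, 1} else c (star_edge P w))" for w
  have b0: "0 \<le> b w" if "w \<in> {0<..<n}" for w
    using that top star unfolding b_def star_edge_def by auto
  have "c e \<le> b (\<phi> e)" if e: "e \<in> T" for e
  proof -
    have eK: "e \<in> Kn_edges n" using e T by (auto simp: spanning_tree_def)
    show ?thesis
    proof (cases "\<phi> e = 1")
      case True
      then show ?thesis using top eK by (simp add: b_def)
    next
      case False
      define w where "w = \<phi> e"
      have w: "w \<in> {2..<n}" "w \<in> e" using \<phi>(2,3)[OF e] False by (auto simp: w_def)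
      obtain u where u: "e = {u, w}" using w eK unfolding Kn_edges_def by blast
      have "c e \<le> c (star_edge P w)"
      proof -
        consider "u = 0" | "u = 1" | "0 \<notin> e" "1 \<notin> e" using u w by force
        then show ?thesis
        proof cases
          case 3
          then show ?thesis using other[OF eK] star[OF w(1)] by (simp add: star_edge_def)
        qed (use P[OF _ w(1)] in \<open>auto simp: star_edge_def u\<close>)
      qed
      then show ?thesis using False by (simp add: b_def w_def)
    qed
  qed
  then have "sum c T \<le> sum (b \<circ> \<phi>) T" by (auto intro: sum_mono)
  also have "\<dots> = sum b (\<phi> ` T)" using \<phi>(1) by (simp add: sum.reindex)
  also have "\<dots> \<le> sum b {0<..<n}"
    using \<phi>(3) b0 by (intro sum_mono2) auto
  also have "{0<..<n} = insert 1 {2..<n}" using n by auto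
  also have "sum b (insert 1 {2..<n}) = c {0, 1} + sum (c \<circ> star_edge P) {2..<n}"
    by (subst sum.insert) (auto simp: b_def intro!: sum.cong)
  also have "\<dots> = c {0, 1} + sum c (star_edge P ` {2..<n})"
    using inj_star_edge[of P n] by (simp add: sum.reindex)
  also have "\<dots> = sum c (double_star n P)"
  proof -
    have "{0, 1} \<notin> star_edge P ` {2..<n}" using star_edge_neq by blast
    then show ?thesis by (simp add: double_star_def)
  qed
  finally show ?thesis .
qed

section \<open>Random profits\<close>

text \<open>Fubini with coordinate \<open>x\<close> integrated first: a measurable set all of whose
  fibres in direction \<open>x\<close> are null is null.\<close>

lemma (in product_sigma_finite) AE_PiM_fun_upd:
  assumes I: "finite I" "x \<in> I"
    and P[measurable]: "Measurable.pred (PiM I M) P"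
    and ae: "\<And>v. v \<in> space (PiM I M) \<Longrightarrow> AE t in M x. P (v(x := t))"
  shows "AE v in PiM I M. P v"
proof -
  let ?J = "I - {x}"
  have IJ: "insert x ?J = I" using I by auto
  define h where "h v = (indicator {v. \<not> P v} v :: ennreal)" for v :: "'i \<Rightarrow> 'a"
  have h: "h \<in> borel_measurable (PiM (insert x ?J) M)"
    unfolding h_def IJ indicator_def by measurable
  have "(\<integral>\<^sup>+ v. h v \<partial>PiM I M) = (\<integral>\<^sup>+ v. \<integral>\<^sup>+ t. h (v(x := t)) \<partial>M x \<partial>PiM ?J M)"
    using product_nn_integral_insert[OF _ _ h] I IJ by simp
  also have "\<dots> = (\<integral>\<^sup>+ v. 0 \<partial>PiM ?J M)"
  proof (rule nn_integral_cong)
    fix v assume v: "v \<in> space (PiM ?J M)"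
    show "(\<integral>\<^sup>+ t. h (v(x := t)) \<partial>M x) = 0"
    \<comment> \<open>The assumption \<open>ae\<close> concerns points of the full product, so
      \<open>v\<close> first has to be given some value at \<open>x\<close>.\<close>
    proof (cases "space (M x) = {}")
      case True
      then show ?thesis by (subst nn_integral_cong[where v = "\<lambda>_. 0"]) auto
    next
      case False
      then obtain s where s: "s \<in> space (M x)" by auto
      have "v(x := s) \<in> space (PiM I M)"
        using v s I by (auto simp: space_PiM PiE_def Pi_def extensional_def)
      from ae[OF this] have "AE t in M x. h (v(x := t)) = 0"
        by (auto simp: h_def)
      then have "(\<integral>\<^sup>+ t. h (v(x := t)) \<partial>M x) = (\<integral>\<^sup>+ t. 0 \<partial>M x)" by (rule nn_integral_cong_AE)
      then show ?thesis by simp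
    qed
  qed
  finally have "(\<integral>\<^sup>+ v. h v \<partial>PiM I M) = 0" by simp
  then have "AE v in PiM I M. h v = 0"
    using h IJ by (subst (asm) nn_integral_0_iff_AE) auto
  then show ?thesis by eventually_elim (auto simp: h_def indicator_def split: if_splits)
qed

section \<open>Uniform distributions on intervals of length 1/4\<close>

definition quarter_uniform :: "real \<Rightarrow> real measure" where
  "quarter_uniform a = density lborel (\<lambda>x. ennreal (4 * indicator {a..a + 1/4} x))"

lemma sets_quarter_uniform [simp, measurable_cong]: "sets (quarter_uniform a) = sets borel"
  by (simp add: quarter_uniform_def)

lemma space_quarter_uniform [simp]: "space (quarter_uniform a) = UNIV"
  by (simp add: quarter_uniform_def)

lemma emeasure_quarter_uniform:
  assumes "A \<in> sets borel"
  shows "emeasure (quarter_uniform a) A = 4 * emeasure lborel (A \<inter> {a..a + 1/4})"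
proof -
  have "emeasure (quarter_uniform a) A =
      (\<integral>\<^sup>+ x. 4 * indicator (A \<inter> {a..a + 1/4}) x \<partial>lborel)"
    unfolding quarter_uniform_def using assms
    by (subst emeasure_density) (auto simp: indicator_def intro!: nn_integral_cong)
  then show ?thesis using assms by (simp add: nn_integral_cmult)
qed

lemma emeasure_quarter_uniform_superset:
  assumes "A \<in> sets borel" "{a..a + 1/4} \<subseteq> A"
  shows "emeasure (quarter_uniform a) A = 1"
proof -
  have "A \<inter> {a..a + 1/4} = {a..a + 1/4}" using assms by auto
  then show ?thesis using assms
    by (simp add: emeasure_quarter_uniform ennreal_mult''[symmetric]
        flip: ennreal_numeral ennreal_1 del: ennreal_1)
qed

lemma prob_space_quarter_uniform: "prob_space (quarter_uniform a)"
  by (rule prob_spaceI) (simp add: emeasure_quarter_uniform_superset)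

lemma AE_quarter_uniform: "AE x in quarter_uniform a. a \<le> x \<and> x \<le> a + 1/4"
  unfolding quarter_uniform_def by (subst AE_density) (auto simp: indicator_def)

lemma AE_quarter_uniform_neq: "AE x in quarter_uniform a. x \<noteq> b"
  unfolding quarter_uniform_def
  by (subst AE_density) (use AE_lborel_singleton[of b] in \<open>auto elim: eventually_mono\<close>)

lemma semirandom_quarter_uniform:
  assumes "-1 \<le> a" "a + 1/4 \<le> 1"
  shows "semirandom 4 (quarter_uniform a)"
  unfolding semirandom_def
proof (intro conjI exI[of _ "\<lambda>x. 4 * indicator {a..a + 1/4} x"])
  show "emeasure (quarter_uniform a) {-1..1} = 1"
    using assms by (intro emeasure_quarter_uniform_superset) auto
qed (simp_all add: prob_space_quarter_uniform, auto simp: quarter_uniform_def indicator_def)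

text \<open>Left ends of the profit intervals, whose length 1/4 corresponds to density 4. The three
  intervals are disjoint, and the level is symmetric in the vertices 0 and 1, so that exchanging
  these preserves the distribution.\<close>

definition edge_level :: "nat set \<Rightarrow> real" where
  "edge_level e = (if e = {0, 1} then 3/4 else if 0 \<in> e \<or> 1 \<in> e then 0 else -1)"

definition profit_space :: "nat \<Rightarrow> nat \<Rightarrow> (nat \<times> nat set \<Rightarrow> real) measure" where
  "profit_space d n = PiM ({..<d} \<times> Kn_edges n) (\<lambda>(i, e). quarter_uniform (edge_level e))"

lemma prob_space_profit_space: "prob_space (profit_space d n)"
  unfolding profit_space_def by (rule prob_space_PiM) (auto simp: prob_space_quarter_uniform)

lemma measurable_profit [measurable]:
  assumes "i < d" "e \<in> Kn_edges n"
  shows "(\<lambda>v. v (i, e)) \<in> borel_measurable (profit_space d n)"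
proof -
  let ?M = "\<lambda>(i, e). quarter_uniform (edge_level e)"
  have "(\<lambda>v. v (i, e)) \<in> measurable (PiM ({..<d} \<times> Kn_edges n) ?M) (?M (i, e))"
    using assms by (intro measurable_component_singleton) auto
  also have "measurable (PiM ({..<d} \<times> Kn_edges n) ?M) (?M (i, e)) = borel_measurable (profit_space d n)"
    unfolding profit_space_def by (intro measurable_cong_sets) auto
  finally show ?thesis .
qed

lemma AE_profit_bounds:
  "AE v in profit_space d n. \<forall>i<d. \<forall>e\<in>Kn_edges n.
     edge_level e \<le> v (i, e) \<and> v (i, e) \<le> edge_level e + 1/4"
proof -
  have "AE v in profit_space d n. \<forall>x\<in>{..<d} \<times> Kn_edges n.
      edge_level (snd x) \<le> v x \<and> v x \<le> edge_level (snd x) + 1/4"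
    unfolding profit_space_def
  proof (rule AE_finite_allI)
    fix x :: "nat \<times> nat set" assume "x \<in> {..<d} \<times> Kn_edges n"
    moreover obtain i e where "x = (i, e)" by (cases x)
    ultimately show "AE v in PiM ({..<d} \<times> Kn_edges n) (\<lambda>(i, e). quarter_uniform (edge_level e)).
        edge_level (snd x) \<le> v x \<and> v x \<le> edge_level (snd x) + 1/4"
      using AE_quarter_uniform[of "edge_level e"]
      by (intro AE_PiM_component[of _ _ _ "\<lambda>t. edge_level (snd x) \<le> t \<and> t \<le> edge_level (snd x) + 1/4"])
        (auto simp: prob_space_quarter_uniform)
  qed (auto simp: finite_Kn_edges)
  then show ?thesis by eventually_elim auto
qed

section \<open>Profit gaps and their generic determinants\<close>

definition star_gap :: "(nat \<times> nat set \<Rightarrow> real) \<Rightarrow> nat \<Rightarrow> nat \<Rightarrow> real" where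
  "star_gap v i w = v (i, {0, w}) - v (i, {1, w})"

text \<open>Rows belong to vertices and columns to objectives. Selecting both by sequences makes the
  matrix of size \<open>m\<close> the leading block of that of size \<open>Suc m\<close>, which
  suits induction.\<close>

definition gap_mat :: "(nat \<times> nat set \<Rightarrow> real) \<Rightarrow> (nat \<Rightarrow> nat) \<Rightarrow> (nat \<Rightarrow> nat) \<Rightarrow> nat \<Rightarrow> real mat" where
  "gap_mat v C W m = Matrix.mat m m (\<lambda>(r, c). star_gap v (C c) (W r))"

lemma gap_mat_carrier [simp]: "gap_mat v C W m \<in> carrier_mat m m"
  by (simp add: gap_mat_def)

lemma measurable_star_gap:
  assumes "i < d" "w \<in> {2..<n}"
  shows "(\<lambda>v. star_gap v i w) \<in> borel_measurable (profit_space d n)"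
proof -
  have "{0, w} \<in> Kn_edges n" "{1, w} \<in> Kn_edges n" using assms by (auto intro!: Kn_edgesI)
  then show ?thesis unfolding star_gap_def using assms(1) by measurable
qed

lemma measurable_det_gap_mat:
  assumes C: "C ` {..<m} \<subseteq> {..<d}" and W: "W ` {..<m} \<subseteq> {2..<n}"
  shows "(\<lambda>v. Determinant.det (gap_mat v C W m)) \<in> borel_measurable (profit_space d n)"
proof -
  have "(\<lambda>v. signof p * (\<Prod>r = 0..<m. star_gap v (C (p r)) (W r))) \<in> borel_measurable (profit_space d n)"
    if p: "p permutes {0..<m}" for p
  proof -
    have "p r < m" if "r < m" for r using permutes_in_image[OF p, of r] that by auto
    then have "(\<lambda>v. star_gap v (C (p r)) (W r)) \<in> borel_measurable (profit_space d n)"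
      if "r < m" for r using that C W by (intro measurable_star_gap) auto
    then show ?thesis by (intro borel_measurable_times borel_measurable_prod borel_measurable_const) auto
  qed
  moreover have "Determinant.det (gap_mat v C W m) =
      (\<Sum>p\<in>{p. p permutes {0..<m}}. signof p * (\<Prod>r = 0..<m. star_gap v (C (p r)) (W r)))" for v
    unfolding det_def'[OF gap_mat_carrier]
    by (intro sum.cong refl arg_cong2[where f = "(*)"] prod.cong)
      (auto simp: gap_mat_def dest: permutes_in_image)
  ultimately show ?thesis by (simp only:) (intro borel_measurable_sum, simp)
qed

text \<open>Laplace expansion along the last row, with the corner entry split off; the conditional
  index skips the deleted column \<open>c\<close>.\<close>

lemma det_gap_mat_Suc:
  "Determinant.det (gap_mat v C W (Suc m)) =
     star_gap v (C m) (W m) * Determinant.det (gap_mat v C W m) +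
     (\<Sum>c<m. star_gap v (C c) (W m) * ((-1) ^ (m + c) *
        Determinant.det (Matrix.mat m m (\<lambda>(r, c'). star_gap v (C (if c' < c then c' else Suc c')) (W r)))))"
proof -
  let ?A = "gap_mat v C W (Suc m)"
  have del: "mat_delete ?A m c = Matrix.mat m m (\<lambda>(r, c'). star_gap v (C (if c' < c then c' else Suc c')) (W r))"
    for c by (auto simp: mat_delete_def gap_mat_def)
  have last: "mat_delete ?A m m = gap_mat v C W m"
    unfolding del by (auto simp: gap_mat_def)
  have "Determinant.det ?A = (\<Sum>c<Suc m. ?A $$ (m, c) * cofactor ?A m c)"
    by (rule laplace_expansion_row) auto
  also have "\<dots> = star_gap v (C m) (W m) * Determinant.det (gap_mat v C W m) +
      (\<Sum>c<m. ?A $$ (m, c) * cofactor ?A m c)"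
    by (simp add: cofactor_def last) (simp add: gap_mat_def)
  also have "(\<Sum>c<m. ?A $$ (m, c) * cofactor ?A m c) = (\<Sum>c<m. star_gap v (C c) (W m) * ((-1) ^ (m + c) *
        Determinant.det (Matrix.mat m m (\<lambda>(r, c'). star_gap v (C (if c' < c then c' else Suc c')) (W r)))))"
    unfolding cofactor_def del by (intro sum.cong) (auto simp: gap_mat_def)
  finally show ?thesis .
qed

text \<open>The lower bounds keep \<open>{0, w}\<close> apart from \<open>{1, w'}\<close>, so a
  single profit influences a single gap.\<close>

lemma star_gap_fun_upd:
  assumes "2 \<le> w" "2 \<le> w'"
  shows "star_gap (v((i, {0, w}) := t)) j w' = (if i = j \<and> w = w' then t - v (i, {1, w}) else star_gap v j w')"
  using assms by (auto simp: star_gap_def doubleton_eq_iff)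

text \<open>By Laplace expansion, the determinant of size \<open>m + 1\<close> is an affine function of the profit of
  \<open>{0, W m}\<close> in objective \<open>C m\<close>, with the determinant of size \<open>m\<close> as slope.\<close>

lemma AE_det_gap_mat:
  assumes "inj_on C {..<m}" "C ` {..<m} \<subseteq> {..<d}" "inj_on W {..<m}" "W ` {..<m} \<subseteq> {2..<n}"
  shows "AE v in profit_space d n. Determinant.det (gap_mat v C W m) \<noteq> 0"
  using assms
proof (induction m)
  case 0
  then show ?case by (simp add: det_dim_zero[OF gap_mat_carrier])
next
  case (Suc m)
  let ?D = "\<lambda>v. Determinant.det (gap_mat v C W m)"
  let ?R = "\<lambda>v. \<Sum>c<m. star_gap v (C c) (W m) * ((-1) ^ (m + c) *
        Determinant.det (Matrix.mat m m (\<lambda>(r, c'). star_gap v (C (if c' < c then c' else Suc c')) (W r))))"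
  let ?x = "(C m, {0, W m})"
  have W: "2 \<le> W r" "W r < n" if "r < Suc m" for r using Suc.prems(4) that by (auto simp: image_subset_iff)
  have Wneq: "W r \<noteq> W m" if "r < m" for r using inj_onD[OF Suc.prems(3), of r m] that by auto
  have Cneq: "C c \<noteq> C m" if "c < m" for c using inj_onD[OF Suc.prems(1), of c m] that by auto
  have Cm: "C m < d" using Suc.prems(2) by auto
  have IH: "AE v in profit_space d n. ?D v \<noteq> 0"
    using Suc.prems by (intro Suc.IH) (simp_all add: lessThan_Suc inj_on_insert)
  \<comment> \<open>Allowing \<open>?D v = 0\<close> as an alternative makes the claim true on every
    fibre, as the fibre lemma requires; the induction hypothesis removes the alternative
    afterwards.\<close>
  have "AE v in profit_space d n. ?D v = 0 \<or> Determinant.det (gap_mat v C W (Suc m)) \<noteq> 0"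
    unfolding profit_space_def
  proof (rule product_sigma_finite.AE_PiM_fun_upd[where x = ?x], goal_cases)
    case 1
    show ?case
      using prob_space_imp_sigma_finite[OF prob_space_quarter_uniform]
      by (simp add: product_sigma_finite_def)
  next
    case 3
    show ?case using W[of m] Cm by (auto intro!: Kn_edgesI)
  next
    case 4
    have "C ` {..<m} \<subseteq> {..<d}" "W ` {..<m} \<subseteq> {2..<n}"
      using Suc.prems by (simp_all add: lessThan_Suc)
    from measurable_det_gap_mat[OF this] measurable_det_gap_mat[OF Suc.prems(2,4)]
    show ?case unfolding profit_space_def[symmetric] by measurable
  next
    case (5 v)
    have upd: "star_gap (v(?x := t)) c (W r) = star_gap v c (W r)" if "r < m" for t c r
      using that W[of r] W[of m] Wneq[of r] by (auto simp: star_gap_fun_upd)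
    have updC: "star_gap (v(?x := t)) (C c) (W m) = star_gap v (C c) (W m)" if "c < m" for t c
      using that W[of m] Cneq[of c] by (auto simp: star_gap_fun_upd)
    have D: "?D (v(?x := t)) = ?D v" for t
      unfolding gap_mat_def by (intro arg_cong[where f = Determinant.det] eq_matI) (simp_all add: upd del: fun_upd_apply)
    have R: "?R (v(?x := t)) = ?R v" for t
    proof (rule sum.cong)
      fix c assume "c \<in> {..<m}"
      moreover have "Matrix.mat m m (\<lambda>(r, c'). star_gap (v(?x := t)) (C (if c' < c then c' else Suc c')) (W r)) =
          Matrix.mat m m (\<lambda>(r, c'). star_gap v (C (if c' < c then c' else Suc c')) (W r))"
        by (rule eq_matI) (simp_all add: upd del: fun_upd_apply)
      ultimately show "star_gap (v(?x := t)) (C c) (W m) * ((-1) ^ (m + c) * Determinant.det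
            (Matrix.mat m m (\<lambda>(r, c'). star_gap (v(?x := t)) (C (if c' < c then c' else Suc c')) (W r)))) =
          star_gap v (C c) (W m) * ((-1) ^ (m + c) * Determinant.det
            (Matrix.mat m m (\<lambda>(r, c'). star_gap v (C (if c' < c then c' else Suc c')) (W r))))"
        using updC by (simp only: lessThan_iff)
    qed simp
    have last: "star_gap (v(?x := t)) (C m) (W m) = t - v (C m, {1, W m})" for t
      using W[of m] by (simp add: star_gap_fun_upd del: fun_upd_apply)
    \<comment> \<open>For \<open>?D v\<close> nonzero, the excluded value is the only root of the
      affine function of \<open>t\<close>.\<close>
    have "AE t in quarter_uniform (edge_level {0, W m}). t \<noteq> v (C m, {1, W m}) - ?R v / ?D v"
      by (rule AE_quarter_uniform_neq)
    then have "AE t in quarter_uniform (edge_level {0, W m}).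
        ?D (v(?x := t)) = 0 \<or> Determinant.det (gap_mat (v(?x := t)) C W (Suc m)) \<noteq> 0"
    proof eventually_elim
      case (elim t)
      show ?case
        unfolding det_gap_mat_Suc D R last using elim by (auto simp: field_simps)
    qed
    then show ?case by (simp only: prod.case)
  qed (auto simp: finite_Kn_edges)
  with IH show ?case by eventually_elim auto
qed

lemma AE_all_det_gap_mat:
  "AE v in profit_space d n. \<forall>m\<le>d. \<forall>C W :: nat \<Rightarrow> nat. inj_on C {..<m} \<longrightarrow> C ` {..<m} \<subseteq> {..<d} \<longrightarrow>
     inj_on W {..<m} \<longrightarrow> W ` {..<m} \<subseteq> {2..<n} \<longrightarrow> Determinant.det (gap_mat v C W m) \<noteq> 0"
proof -
  \<comment> \<open>Restriction to extensional \<open>C\<close> and \<open>W\<close> leaves finitely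
    many null sets to unite; values outside \<open>{..<m}\<close> do not affect the matrix.\<close>
  have "AE v in profit_space d n. \<forall>m\<in>{..d}. \<forall>C\<in>{..<m::nat} \<rightarrow>\<^sub>E {..<d}. \<forall>W\<in>{..<m::nat} \<rightarrow>\<^sub>E {2..<n}.
     inj_on C {..<m} \<longrightarrow> inj_on W {..<m} \<longrightarrow> Determinant.det (gap_mat v C W m) \<noteq> 0"
  proof (intro AE_finite_allI finite_PiE finite_atMost finite_lessThan finite_atLeastLessThan)
    fix m and C W :: "nat \<Rightarrow> nat" assume "C \<in> {..<m} \<rightarrow>\<^sub>E {..<d}" "W \<in> {..<m} \<rightarrow>\<^sub>E {2..<n}"
    then have "C ` {..<m} \<subseteq> {..<d}" "W ` {..<m} \<subseteq> {2..<n}" by (auto simp: PiE_iff)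
    then show "AE v in profit_space d n. inj_on C {..<m} \<longrightarrow> inj_on W {..<m} \<longrightarrow>
        Determinant.det (gap_mat v C W m) \<noteq> 0"
      using AE_det_gap_mat[of C m d W n]
      by (cases "inj_on C {..<m} \<and> inj_on W {..<m}") auto
  qed
  then show ?thesis
  proof eventually_elim
    case (elim v)
    show ?case
    proof (intro allI impI)
      fix m and C W :: "nat \<Rightarrow> nat"
      assume *: "m \<le> d" "inj_on C {..<m}" "C ` {..<m} \<subseteq> {..<d}" "inj_on W {..<m}" "W ` {..<m} \<subseteq> {2..<n}"
      have "restrict C {..<m} \<in> {..<m} \<rightarrow>\<^sub>E {..<d}" "restrict W {..<m} \<in> {..<m} \<rightarrow>\<^sub>E {2..<n}"
        using * by auto
      moreover have "gap_mat v (restrict C {..<m}) (restrict W {..<m}) m = gap_mat v C W m"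
        unfolding gap_mat_def by (rule eq_matI) auto
      ultimately show "Determinant.det (gap_mat v C W m) \<noteq> 0"
        using elim * by (metis atMost_iff inj_on_restrict_eq)
    qed
  qed
qed

section \<open>Hyperplanes in general position\<close>

lemma mat_row_sum:
  assumes "r < m"
  shows "Matrix.vec_index (Matrix.mat m m f *\<^sub>v Matrix.vec m x) r = (\<Sum>c<m. f (r, c) * x c)"
  using assms by (simp add: scalar_prod_def lessThan_atLeast0)

lemma gap_mat_solvable:
  assumes "Determinant.det (gap_mat v C W m) \<noteq> 0"
  shows "\<exists>x. \<forall>r<m. (\<Sum>c<m. star_gap v (C c) (W r) * x c) = b r"
proof -
  let ?A = "gap_mat v C W m" and ?b = "Matrix.vec m b"
  define B where "B = (1 / Determinant.det ?A) \<cdot>\<^sub>m adj_mat ?A"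
  have B: "B \<in> carrier_mat m m" "?A * B = 1\<^sub>m m"
    using assms adj_mat[OF gap_mat_carrier[of v C W m]] unfolding B_def
    by (auto simp: mult_smult_distrib[OF gap_mat_carrier] intro!: eq_matI)
  define y where "y = B *\<^sub>v ?b"
  have y: "y \<in> carrier_vec m" using B by (auto simp: y_def)
  have "?A *\<^sub>v y = (?A * B) *\<^sub>v ?b"
    unfolding y_def using assoc_mult_mat_vec[OF gap_mat_carrier B(1), of ?b] by simp
  also have "\<dots> = ?b" by (simp add: B)
  finally have eq: "?A *\<^sub>v y = ?b" .
  have "(\<Sum>c<m. star_gap v (C c) (W r) * (Matrix.vec_index y c)) = b r" if r: "r < m" for r
  proof -
    have "y = Matrix.vec m (\<lambda>c. Matrix.vec_index y c)" using y by auto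
    then have "Matrix.vec m (Matrix.vec_index y) = y" by simp
    then have "(\<Sum>c<m. star_gap v (C c) (W r) * (Matrix.vec_index y c)) = Matrix.vec_index (?A *\<^sub>v y) r"
      unfolding gap_mat_def using mat_row_sum[OF r, of "\<lambda>(r, c). star_gap v (C c) (W r)" "Matrix.vec_index y"] by simp
    then show ?thesis using eq r by simp
  qed
  then show ?thesis by blast
qed

lemma gap_mat_kernel:
  assumes "Determinant.det (gap_mat v C W m) \<noteq> 0"
    and "\<And>r. r < m \<Longrightarrow> (\<Sum>c<m. star_gap v (C c) (W r) * x c) = 0" and "c < m"
  shows "x c = 0"
proof -
  have "gap_mat v C W m *\<^sub>v Matrix.vec m x = 0\<^sub>v m"
    by (rule eq_vecI) (use assms(2) in \<open>simp_all add: gap_mat_def mat_row_sum del: index_mult_mat_vec\<close>)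
  then have "Matrix.vec m x = 0\<^sub>v m"
    using assms(1) det_0_iff_vec_prod_zero[OF gap_mat_carrier] by (metis vec_carrier)
  then show ?thesis using \<open>c < m\<close> by (metis index_vec index_zero_vec(1))
qed

text \<open>The forms in \<open>S\<close> meet in a point \<open>p\<close> where no other form of
  \<open>X\<close> vanishes. Near \<open>p\<close> the other signs are constant, and since the
  linear parts over \<open>S\<close> take arbitrary values, some direction out of \<open>p\<close>
  realizes each sign pattern on \<open>S\<close>.\<close>

lemma simple_vertex_cube:
  fixes \<alpha> :: "'w \<Rightarrow> real" and \<beta> :: "'w \<Rightarrow> nat \<Rightarrow> real" and k :: nat
  defines "f \<equiv> \<lambda>w y. \<alpha> w + (\<Sum>c<k. \<beta> w c * y c)"
  assumes X: "finite X" "S \<subseteq> X"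
    and solve: "\<And>b. \<exists>x. \<forall>w\<in>S. (\<Sum>c<k. \<beta> w c * x c) = b w"
    and simple: "\<And>y w. \<forall>w\<in>S. f w y = 0 \<Longrightarrow> w \<in> X - S \<Longrightarrow> f w y \<noteq> 0"
  shows "\<exists>B. B \<inter> S = {} \<and> (\<forall>Q\<subseteq>S. \<exists>y. (\<forall>c<k. y c \<noteq> 0) \<and> {w\<in>X. 0 < f w y} = B \<union> Q)"
proof -
  have ev_neq: "eventually (\<lambda>t. a + t * b \<noteq> 0) (at_right 0)" if "b \<noteq> 0" for a b :: real
  proof -
    have "eventually (\<lambda>t. t \<noteq> - a / b) (at_right 0)" by (rule eventually_neq_at_within)
    then show ?thesis by eventually_elim (use that in \<open>auto simp: field_simps\<close>)
  qed
  have ev_pos: "eventually (\<lambda>t. 0 < a + t * b) (at_right 0)" if "0 < a" for a b :: real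
  proof -
    have "((\<lambda>t. a + t * b) \<longlongrightarrow> a + 0 * b) (at_right 0)" by (intro tendsto_intros)
    then show ?thesis using that by (intro order_tendstoD(1)) auto
  qed
  have ev_neg: "eventually (\<lambda>t. a + t * b < 0) (at_right 0)" if "a < 0" for a b :: real
    using ev_pos[of "- a" "- b"] that by (auto elim: eventually_mono)
  obtain p where p: "\<forall>w\<in>S. (\<Sum>c<k. \<beta> w c * p c) = - \<alpha> w" using solve[of "\<lambda>w. - \<alpha> w"] by blast
  then have fp: "f w p = 0" if "w \<in> S" for w using that by (simp add: f_def)
  \<comment> \<open>The forms outside \<open>S\<close> that are positive at \<open>p\<close> stay
    positive nearby, so \<open>B\<close> serves every \<open>Q\<close>.\<close>
  define B where "B = {w\<in>X - S. 0 < f w p}"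
  have "\<exists>y. (\<forall>c<k. y c \<noteq> 0) \<and> {w\<in>X. 0 < f w y} = B \<union> Q" if Q: "Q \<subseteq> S" for Q
  proof -
    define s where "s w = (if w \<in> Q then 1 else - 1 :: real)" for w
    obtain u where u: "\<forall>w\<in>S. (\<Sum>c<k. \<beta> w c * u c) = s w" using solve[of s] by blast
    have finS: "finite S" using X finite_subset by blast
    txt \<open>Moving from the vertex \<open>p\<close> in direction \<open>u\<close> realizes the signs prescribed by \<open>Q\<close>; the small
      shift \<open>t\<close> makes the coordinates of the direction, hence of the point reached, nonzero.\<close>
    have "eventually (\<lambda>t. (\<forall>c\<in>{..<k}. u c + t * 1 \<noteq> 0) \<and>
        (\<forall>w\<in>S. 0 < 1 + t * (s w * (\<Sum>c<k. \<beta> w c)))) (at_right 0)"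
      using finS by (intro eventually_conj eventually_ball_finite ballI ev_neq ev_pos) auto
    then obtain t where t: "\<forall>c<k. u c + t \<noteq> 0" "\<forall>w\<in>S. 0 < 1 + t * (s w * (\<Sum>c<k. \<beta> w c))"
      using eventually_happens'[OF trivial_limit_at_right_real] by force
    define g where "g w = (\<Sum>c<k. \<beta> w c * (u c + t))" for w
    have g: "g w = s w + t * (\<Sum>c<k. \<beta> w c)" if "w \<in> S" for w
      using u that by (simp add: g_def algebra_simps sum.distrib sum_distrib_left)
    have gpos: "0 < g w" if "w \<in> Q" for w
      using bspec[OF t(2), of w] Q that g[of w] by (auto simp: s_def)
    have gneg: "g w < 0" if "w \<in> S - Q" for w
      using bspec[OF t(2), of w] that g[of w] by (auto simp: s_def)
    have fshift: "f w (\<lambda>c. p c + h * (u c + t)) = f w p + h * g w" for w h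
      by (simp add: f_def g_def algebra_simps sum.distrib sum_distrib_left)
    have finB: "finite B" "finite (X - S - B)" using X by (auto simp: B_def)
    \<comment> \<open>With the direction fixed, the step length \<open>h\<close> is taken small.
      Each direction coordinate is nonzero, so at most one \<open>h\<close> per coordinate is bad,
      even if \<open>p\<close> has zero coordinates.\<close>
    have "eventually (\<lambda>h. \<forall>c\<in>{..<k}. p c + h * (u c + t) \<noteq> 0) (at_right 0)"
      using t(1) by (intro eventually_ball_finite ballI ev_neq) auto
    moreover have "eventually (\<lambda>h. \<forall>w\<in>B. 0 < f w p + h * g w) (at_right 0)"
      using finB by (intro eventually_ball_finite ballI ev_pos) (auto simp: B_def)
    moreover have "f w p < 0" if "w \<in> X - S - B" for w
      using simple[of p w] fp that by (force simp: B_def)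
    then have "eventually (\<lambda>h. \<forall>w\<in>X - S - B. f w p + h * g w < 0) (at_right 0)"
      using finB by (intro eventually_ball_finite ballI ev_neg)
    moreover have "eventually (\<lambda>h. 0 < h) (at_right (0::real))" by (rule eventually_at_right_less)
    ultimately have "eventually (\<lambda>h. (\<forall>c\<in>{..<k}. p c + h * (u c + t) \<noteq> 0) \<and>
        (\<forall>w\<in>B. 0 < f w p + h * g w) \<and> (\<forall>w\<in>X - S - B. f w p + h * g w < 0) \<and> 0 < h) (at_right 0)"
      by eventually_elim blast
    from eventually_happens'[OF trivial_limit_at_right_real this]
    obtain h where h: "\<forall>c\<in>{..<k}. p c + h * (u c + t) \<noteq> 0"
      "\<forall>w\<in>B. 0 < f w p + h * g w" "\<forall>w\<in>X - S - B. f w p + h * g w < 0" "0 < h"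
      by (elim exE conjE)
    have iff: "0 < f w (\<lambda>c. p c + h * (u c + t)) \<longleftrightarrow> w \<in> B \<union> Q" if w: "w \<in> X" for w
    proof (cases "w \<in> S")
      case True
      then have "w \<notin> B" by (simp add: B_def)
      then show ?thesis
        using fp[OF True] gpos[of w] gneg[of w] h(4) True
        by (cases "w \<in> Q") (simp_all add: fshift zero_less_mult_iff)
    next
      case False
      then have "w \<notin> Q" using Q by auto
      then show ?thesis using False w h(2,3) by (cases "w \<in> B") (force simp: fshift)+
    qed
    have "{w\<in>X. 0 < f w (\<lambda>c. p c + h * (u c + t))} = {w\<in>X. w \<in> B \<union> Q}"
      using iff by (simp cong: conj_cong)
    also have "\<dots> = B \<union> Q" using Q X by (auto simp: B_def)
    finally show ?thesis using h(1) by (intro exI[of _ "\<lambda>c. p c + h * (u c + t)"]) simp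
  qed
  then show ?thesis by (intro exI[of _ B]) (auto simp: B_def)
qed

section \<open>Sign flips and Pareto-optimal trees\<close>

definition swap01 :: "nat set \<Rightarrow> nat set" where
  "swap01 e = Transposition.transpose 0 1 ` e"

text \<open>Exchanging 0 and 1 in only some objectives is in general no isomorphism of the instance:
  the Pareto set may change, while the distribution of the profits does not.\<close>

definition flip :: "nat set \<Rightarrow> nat \<times> nat set \<Rightarrow> nat \<times> nat set" where
  "flip g = (\<lambda>(i, e). (i, if i \<in> g then swap01 e else e))"

lemma swap01_swap01 [simp]: "swap01 (swap01 e) = e"
  by (simp add: swap01_def image_image)

lemma flip_flip [simp]: "flip g (flip g x) = x"
  by (cases x) (simp add: flip_def)

lemma swap01_edges:
  assumes "2 \<le> n" "e \<in> Kn_edges n"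
  shows "swap01 e \<in> Kn_edges n"
proof -
  let ?\<tau> = "Transposition.transpose 0 (1::nat)"
  obtain u v where uv: "u < n" "v < n" "u \<noteq> v" "e = {u, v}"
    using assms by (auto simp: Kn_edges_def)
  have "?\<tau> w < n" if "w < n" for w using assms that by (auto simp: Transposition.transpose_def)
  moreover have "?\<tau> u \<noteq> ?\<tau> v" using uv(3) by (metis transpose_involutory)
  ultimately have "{?\<tau> u, ?\<tau> v} \<in> Kn_edges n" using uv by (intro Kn_edgesI)
  then show ?thesis by (simp add: swap01_def uv)
qed

lemma swap01_star [simp]:
  "2 \<le> w \<Longrightarrow> swap01 {0, w} = {1, w}" "2 \<le> w \<Longrightarrow> swap01 {1, w} = {0, w}"
  "2 \<le> w \<Longrightarrow> swap01 {Suc 0, w} = {0, w}"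
  by (auto simp: swap01_def Transposition.transpose_def)

text \<open>An edge and its image carry the same distribution, which is why flips preserve the
  product measure.\<close>

lemma edge_level_swap01 [simp]: "edge_level (swap01 e) = edge_level e"
proof -
  have "swap01 {0, 1} = {0, 1}" by (auto simp: swap01_def)
  then have "swap01 e = {0, 1} \<longleftrightarrow> e = {0, 1}" by (metis swap01_swap01)
  moreover have "0 \<in> swap01 e \<longleftrightarrow> 1 \<in> e" "1 \<in> swap01 e \<longleftrightarrow> 0 \<in> e"
    by (force simp: swap01_def image_iff Transposition.transpose_def)+
  ultimately show ?thesis by (auto simp: edge_level_def)
qed

text \<open>Points of the product space are extensional, so \<open>v \<circ> flip g\<close> must be
  replaceable by its restriction to the index set.\<close>

lemma num_pareto_cong:
  assumes "\<And>i e. i < d \<Longrightarrow> e \<in> Kn_edges n \<Longrightarrow> v (i, e) = v' (i, e)"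
  shows "num_pareto d n v = num_pareto d n v'"
proof -
  have eq: "tree_profit v i T = tree_profit v' i T" if "i < d" "spanning_tree n T" for i T
    unfolding tree_profit_def using assms that by (intro sum.cong) (auto simp: spanning_tree_def)
  show ?thesis unfolding num_pareto_def pareto_optimal_def
    by (simp add: eq cong: conj_cong)
qed

lemma measurable_num_pareto:
  "(\<lambda>v. ennreal (real (num_pareto d n v))) \<in> borel_measurable (profit_space d n)"
proof -
  let ?T = "{T. spanning_tree n T}"
  have tp: "(\<lambda>v. tree_profit v i T) \<in> borel_measurable (profit_space d n)"
    if "i < d" "T \<in> ?T" for i T
    unfolding tree_profit_def using that
    by (intro borel_measurable_sum measurable_profit) (auto simp: spanning_tree_def)
  have pred: "Measurable.pred (profit_space d n) (\<lambda>v. pareto_optimal d n v T)" if T: "T \<in> ?T" for T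
  proof -
    have "Measurable.pred (profit_space d n) (\<lambda>v. tree_profit v i T \<le> tree_profit v i T')"
      "Measurable.pred (profit_space d n) (\<lambda>v. tree_profit v i T < tree_profit v i T')"
      if i: "i \<in> {..<d}" "T' \<in> ?T" for i T'
    proof -
      have "(\<lambda>v. tree_profit v i T) \<in> borel_measurable (profit_space d n)"
        "(\<lambda>v. tree_profit v i T') \<in> borel_measurable (profit_space d n)"
        using tp T i by auto
      then show "Measurable.pred (profit_space d n) (\<lambda>v. tree_profit v i T \<le> tree_profit v i T')"
        "Measurable.pred (profit_space d n) (\<lambda>v. tree_profit v i T < tree_profit v i T')"
        unfolding pred_def by (rule borel_measurable_le, rule borel_measurable_less)
    qed
    then have "Measurable.pred (profit_space d n) (\<lambda>v. \<not> (\<exists>T'\<in>?T.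
        (\<forall>i\<in>{..<d}. tree_profit v i T \<le> tree_profit v i T') \<and>
        (\<exists>i\<in>{..<d}. tree_profit v i T < tree_profit v i T')))"
      by (intro pred_intros_logic pred_intros_finite finite_spanning_trees finite_lessThan)
    moreover have "pareto_optimal d n v T \<longleftrightarrow> \<not> (\<exists>T'\<in>?T.
        (\<forall>i\<in>{..<d}. tree_profit v i T \<le> tree_profit v i T') \<and>
        (\<exists>i\<in>{..<d}. tree_profit v i T < tree_profit v i T'))" for v
      using T by (auto simp: pareto_optimal_def)
    ultimately show ?thesis by simp
  qed
  have "real (num_pareto d n v) = (\<Sum>T\<in>?T. if pareto_optimal d n v T then 1 else 0)" for v
  proof -
    have "{T. pareto_optimal d n v T} = {T\<in>?T. pareto_optimal d n v T}"
      by (auto simp: pareto_optimal_def)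
    then show ?thesis unfolding num_pareto_def
      by (simp add: sum.If_cases finite_spanning_trees Int_def)
  qed
  moreover have "(\<lambda>v. \<Sum>T\<in>?T. if pareto_optimal d n v T then 1 else (0::real)) \<in> borel_measurable (profit_space d n)"
    using pred by (intro borel_measurable_sum measurable_If) auto
  ultimately show ?thesis by (simp add: measurable_compose)
qed

text \<open>\<open>flip g\<close> is an involution of the index set that respects the factor
  measures, so reindexing along it leaves the product measure unchanged.\<close>

lemma restrict_flip:
  fixes d n :: nat and g :: "nat set"
  defines "I \<equiv> {..<d} \<times> Kn_edges n"
  assumes "2 \<le> n"
  shows measurable_restrict_flip:
      "(\<lambda>v. \<lambda>x\<in>I. v (flip g x)) \<in> measurable (profit_space d n) (profit_space d n)"
    and distr_restrict_flip:
      "distr (profit_space d n) (profit_space d n) (\<lambda>v. \<lambda>x\<in>I. v (flip g x)) = profit_space d n"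
    and num_pareto_restrict_flip:
      "num_pareto d n (\<lambda>x\<in>I. v (flip g x)) = num_pareto d n (v \<circ> flip g)"
proof -
  let ?M = "\<lambda>(i, e). quarter_uniform (edge_level e)"
  have M: "?M (flip g x) = ?M x" for x
    by (cases x) (simp add: flip_def)
  have inj: "inj_on (flip g) I" by (metis flip_flip inj_onI)
  have into: "flip g \<in> I \<rightarrow> I" using assms by (auto simp: flip_def swap01_edges)
  show "distr (profit_space d n) (profit_space d n) (\<lambda>v. \<lambda>x\<in>I. v (flip g x)) = profit_space d n"
    using distr_PiM_reindex[of I ?M, OF _ inj into] unfolding M profit_space_def I_def[symmetric]
    by (simp add: prob_space_quarter_uniform split: prod.split)
  show "(\<lambda>v. \<lambda>x\<in>I. v (flip g x)) \<in> measurable (profit_space d n) (profit_space d n)"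
    unfolding profit_space_def I_def[symmetric]
  proof (rule measurable_restrict)
    fix x assume x: "x \<in> I"
    then have "(\<lambda>v. v (flip g x)) \<in> measurable (PiM I ?M) (?M (flip g x))"
      using into by (intro measurable_component_singleton) auto
    then show "(\<lambda>v. v (flip g x)) \<in> measurable (PiM I ?M) (?M x)" by (simp only: M)
  qed
  show "num_pareto d n (\<lambda>x\<in>I. v (flip g x)) = num_pareto d n (v \<circ> flip g)"
    by (rule num_pareto_cong) (simp add: I_def)
qed

lemma measurable_num_pareto_flip:
  assumes "2 \<le> n"
  shows "(\<lambda>v. ennreal (real (num_pareto d n (v \<circ> flip g)))) \<in> borel_measurable (profit_space d n)"
  using measurable_compose[OF measurable_restrict_flip[OF assms] measurable_num_pareto]
  by (simp add: num_pareto_restrict_flip[OF assms])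

text \<open>Through this equality every orthant of weights contributes the same expectation.\<close>

lemma nn_integral_num_pareto_flip:
  assumes "2 \<le> n"
  shows "(\<integral>\<^sup>+ v. ennreal (real (num_pareto d n (v \<circ> flip g))) \<partial>profit_space d n) =
    (\<integral>\<^sup>+ v. ennreal (real (num_pareto d n v)) \<partial>profit_space d n)"
proof -
  let ?h = "\<lambda>v. ennreal (real (num_pareto d n v))"
    and ?t = "\<lambda>v. \<lambda>x\<in>{..<d} \<times> Kn_edges n. v (flip g x)"
  have "nn_integral (distr (profit_space d n) (profit_space d n) ?t) ?h =
      (\<integral>\<^sup>+ v. ?h (?t v) \<partial>profit_space d n)"
    by (rule nn_integral_distr[OF measurable_restrict_flip[OF assms]]) (simp add: measurable_num_pareto)
  then show ?thesis
    unfolding distr_restrict_flip[OF assms] num_pareto_restrict_flip[OF assms] by simp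
qed

section \<open>Pareto-optimal double stars from weighted maximization\<close>

lemma pareto_optimalI_weights:
  assumes "spanning_tree n T" and pos: "\<And>i. i < d \<Longrightarrow> 0 < l i"
    and max: "\<And>T'. spanning_tree n T' \<Longrightarrow>
      (\<Sum>i<d. l i * tree_profit v i T') \<le> (\<Sum>i<d. l i * tree_profit v i T)"
  shows "pareto_optimal d n v T"
  unfolding pareto_optimal_def
proof (intro conjI notI)
  assume "\<exists>T'. spanning_tree n T' \<and> (\<forall>i<d. tree_profit v i T \<le> tree_profit v i T') \<and>
    (\<exists>i<d. tree_profit v i T < tree_profit v i T')"
  then obtain T' i where T': "spanning_tree n T'" "\<forall>i<d. tree_profit v i T \<le> tree_profit v i T'"
    "i < d" "tree_profit v i T < tree_profit v i T'" by blast
  \<comment> \<open>Positive weights turn domination into a strictly larger weighted profit.\<close>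
  have "(\<Sum>i<d. l i * tree_profit v i T) < (\<Sum>i<d. l i * tree_profit v i T')"
    using T' pos by (intro sum_strict_mono_ex1 ballI bexI[of _ i] mult_left_mono mult_strict_left_mono)
      (auto simp: less_imp_le)
  then show False using max[OF T'(1)] by simp
qed fact

text \<open>The signs of \<open>\<mu>\<close> are moved into the profits: maximizing with the
  positive weights \<open>\<bar>\<mu> i\<bar>\<close> after the flip selects the sign pattern of the
  unflipped gaps at \<open>\<mu>\<close>.\<close>

lemma pareto_optimal_double_star:
  assumes n: "2 \<le> n" and d: "0 < d"
    and bounds: "\<And>i e. i < d \<Longrightarrow> e \<in> Kn_edges n \<Longrightarrow>
      edge_level e \<le> v (i, e) \<and> v (i, e) \<le> edge_level e + 1/4"
    and \<mu>: "\<And>i. i < d \<Longrightarrow> \<mu> i \<noteq> 0"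
    and P: "P = {w\<in>{2..<n}. 0 < (\<Sum>i<d. star_gap v i w * \<mu> i)}"
  shows "pareto_optimal d n (v \<circ> flip {i. \<mu> i < 0}) (double_star n P)"
proof (rule pareto_optimalI_weights)
  let ?v = "v \<circ> flip {i. \<mu> i < 0}"
  let ?c = "\<lambda>e. \<Sum>i<d. \<bar>\<mu> i\<bar> * ?v (i, e)"
  have vb: "edge_level e \<le> ?v (i, e)" "?v (i, e) \<le> edge_level e + 1/4"
    if "i < d" "e \<in> Kn_edges n" for i e
    using bounds[OF that] bounds[OF that(1) swap01_edges[OF n that(2)]] by (auto simp: flip_def)
  have nn: "0 \<le> ?v (i, e)" if "i < d" "e \<in> Kn_edges n" "0 \<le> edge_level e" for i e
    using vb(1)[OF that(1,2)] that(3) by linarith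
  have 01: "{0, 1} \<in> Kn_edges n" using n by (intro Kn_edgesI) auto
  have star: "{0, w} \<in> Kn_edges n" "{1, w} \<in> Kn_edges n" if "w \<in> {2..<n}" for w
    using that by (auto intro!: Kn_edgesI)
  \<comment> \<open>In a flipped objective the gap changes sign, which combines with
    \<open>\<bar>\<mu> i\<bar>\<close> to the factor \<open>\<mu> i\<close>.\<close>
  have gap: "?c {0, w} - ?c {1, w} = (\<Sum>i<d. star_gap v i w * \<mu> i)" if "w \<in> {2..<n}" for w
    unfolding sum_subtractf[symmetric] using that
    by (intro sum.cong) (auto simp: flip_def star_gap_def algebra_simps)
  fix T assume T: "spanning_tree n T"
  have sum_c: "(\<Sum>i<d. \<bar>\<mu> i\<bar> * tree_profit ?v i T) = sum ?c T" for T
    unfolding tree_profit_def sum_distrib_left by (rule sum.swap)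
  show "(\<Sum>i<d. \<bar>\<mu> i\<bar> * tree_profit ?v i T) \<le> (\<Sum>i<d. \<bar>\<mu> i\<bar> * tree_profit ?v i (double_star n P))"
    unfolding sum_c
  proof (rule double_star_max_weight[OF n T])
    fix e assume e: "e \<in> Kn_edges n"
    show "?c e \<le> ?c {0, 1}"
    proof (cases "e = {0, 1}")
      case False
      \<comment> \<open>The interval of \<open>{0, 1}\<close> lies above all others, whichever
        objectives are flipped.\<close>
      have "?v (i, e) \<le> ?v (i, {0, 1})" if "i < d" for i
        using vb[OF that e] vb[OF that 01] False by (auto simp: edge_level_def split: if_splits)
      then show ?thesis by (intro sum_mono mult_left_mono) auto
    qed simp
  next
    show "0 \<le> ?c {0, 1}"
      using 01 by (intro sum_nonneg mult_nonneg_nonneg nn) (auto simp: edge_level_def)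
  next
    fix w assume w: "w \<in> {2..<n}"
    show "0 \<le> ?c {0, w}"
      using star(1)[OF w] by (intro sum_nonneg mult_nonneg_nonneg nn) (auto simp: edge_level_def)
    show "0 \<le> ?c {1, w}"
      using star(2)[OF w] by (intro sum_nonneg mult_nonneg_nonneg nn) (auto simp: edge_level_def)
  next
    fix e assume e: "e \<in> Kn_edges n" "0 \<notin> e" "1 \<notin> e"
    have "?v (i, e) \<le> 0" if "i < d" for i
    proof -
      have "edge_level e = - 1" using e(2,3) by (auto simp: edge_level_def)
      then show ?thesis using vb(2)[OF that e(1)] by linarith
    qed
    then show "?c e \<le> 0" by (intro sum_nonpos mult_nonneg_nonpos) auto
  next
    fix w assume "w \<in> P" "w \<in> {2..<n}"
    then show "?c {1, w} \<le> ?c {0, w}" using gap[of w] P by auto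
  next
    fix w assume "w \<notin> P" "w \<in> {2..<n}"
    then show "?c {0, w} \<le> ?c {1, w}" using gap[of w] P by auto
  qed
qed (use \<mu> n in \<open>auto simp: spanning_tree_double_star\<close>)

text \<open>The weight of objective 0 is normalized to 1, leaving affine forms in
  \<open>d - 1\<close> variables. Determinants of size \<open>d - 1\<close> provide the vertex of
  \<open>S\<close> and the directions out of it; those of size \<open>d\<close> keep every further
  hyperplane away from that vertex.\<close>

lemma strongly_shatters_pareto:
  assumes n: "2 \<le> n" and d: "0 < d"
    and bounds: "\<And>i e. i < d \<Longrightarrow> e \<in> Kn_edges n \<Longrightarrow>
      edge_level e \<le> v (i, e) \<and> v (i, e) \<le> edge_level e + 1/4"
    and generic: "\<And>m C W. m \<le> d \<Longrightarrow> inj_on C {..<m} \<Longrightarrow> C ` {..<m} \<subseteq> {..<d} \<Longrightarrow>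
      inj_on W {..<m} \<Longrightarrow> W ` {..<m} \<subseteq> {2..<n} \<Longrightarrow> Determinant.det (gap_mat v C W m) \<noteq> 0"
    and S: "S \<subseteq> {2..<n}" "card S = d - 1"
  shows "strongly_shatters {P \<in> Pow {2..<n}.
    \<exists>g\<in>Pow {1..<d}. pareto_optimal d n (v \<circ> flip g) (double_star n P)} S"
proof -
  define k where "k = d - 1"
  have dk: "d = Suc k" using d by (simp add: k_def)
  let ?f = "\<lambda>w y. star_gap v 0 w + (\<Sum>c<k. star_gap v (Suc c) w * y c)"
  have finS: "finite S" using S finite_subset by blast
  then obtain W where W: "bij_betw W {..<k} S"
    using ex_bij_betw_nat_finite[OF finS] S(2) by (auto simp: k_def lessThan_atLeast0)
  have Wimg: "W ` {..<k} = S" and Winj: "inj_on W {..<k}" using W by (auto simp: bij_betw_def)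
  have "\<exists>B. B \<inter> S = {} \<and> (\<forall>Q\<subseteq>S. \<exists>y. (\<forall>c<k. y c \<noteq> 0) \<and> {w\<in>{2..<n}. 0 < ?f w y} = B \<union> Q)"
  proof (rule simple_vertex_cube)
    fix b
    have "Determinant.det (gap_mat v Suc W k) \<noteq> 0"
      using Winj Wimg S dk by (intro generic) auto
    from gap_mat_solvable[OF this, of "b \<circ> W"]
    obtain x where "\<forall>r<k. (\<Sum>c<k. star_gap v (Suc c) (W r) * x c) = b (W r)" by auto
    then show "\<exists>x. \<forall>w\<in>S. (\<Sum>c<k. star_gap v (Suc c) w * x c) = b w"
      unfolding Wimg[symmetric] by auto
  next
    fix y w assume y: "\<forall>w\<in>S. ?f w y = 0" and w: "w \<in> {2..<n} - S"
    show "?f w y \<noteq> 0"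
    proof
      assume w0: "?f w y = 0"
      txt \<open>Then \<open>(y, 1)\<close> is in the kernel of the generic matrix with rows \<open>insert w S\<close>.\<close>
      define C where "C c = (if c < k then Suc c else 0)" for c
      define W' where "W' r = (if r < k then W r else w)" for r
      define x where "x c = (if c < k then y c else 1)" for c
      have W'S: "W' r \<in> insert w S" if "r < Suc k" for r using that Wimg by (auto simp: W'_def)
      have "inj_on W' {..<Suc k}"
      proof (rule inj_onI)
        fix r s assume rs: "r \<in> {..<Suc k}" "s \<in> {..<Suc k}" "W' r = W' s"
        have "W r \<in> S" if "r < k" for r using Wimg that by auto
        then show "r = s" using rs w inj_onD[OF Winj, of r s]
          by (cases "r < k"; cases "s < k") (auto simp: W'_def)
      qed
      moreover have "W' ` {..<Suc k} \<subseteq> {2..<n}"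
      proof -
        have "insert w S \<subseteq> {2..<n}" using w S by auto
        then show ?thesis using W'S by blast
      qed
      moreover have "inj_on C {..<Suc k}" "C ` {..<Suc k} \<subseteq> {..<d}"
        by (auto simp: inj_on_def C_def dk split: if_splits)
      ultimately have "Determinant.det (gap_mat v C W' (Suc k)) \<noteq> 0"
        using dk by (intro generic) auto
      moreover have "(\<Sum>c<Suc k. star_gap v (C c) (W' r) * x c) = 0" if "r < Suc k" for r
      proof -
        have "(\<Sum>c<Suc k. star_gap v (C c) (W' r) * x c) = ?f (W' r) y"
          by (simp add: C_def x_def)
        also have "\<dots> = 0" using W'S[OF that] y w0 by auto
        finally show ?thesis .
      qed
      ultimately have "x k = 0" by (rule gap_mat_kernel) simp_all
      then show False by (simp add: x_def)
    qed
  qed (use S in auto)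
  then obtain B where B: "B \<inter> S = {}"
    "\<And>Q. Q \<subseteq> S \<Longrightarrow> \<exists>y. (\<forall>c<k. y c \<noteq> 0) \<and> {w\<in>{2..<n}. 0 < ?f w y} = B \<union> Q" by blast
  show ?thesis
  proof (rule strongly_shattersI[OF B(1)])
    fix Q assume "Q \<subseteq> S"
    from B(2)[OF this] obtain y where y: "\<forall>c<k. y c \<noteq> 0" "{w\<in>{2..<n}. 0 < ?f w y} = B \<union> Q"
      by blast
    \<comment> \<open>The index shift restores objective 0. The value 1 outside
      \<open>{1..<d}\<close> ensures that only objectives in \<open>{1..<d}\<close> are
      flipped.\<close>
    define \<mu> where "\<mu> i = (if i \<in> {1..<d} then y (i - 1) else 1)" for i
    have f: "(\<Sum>i<d. star_gap v i w * \<mu> i) = ?f w y" for w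
      unfolding dk sum.lessThan_Suc_shift by (simp add: \<mu>_def dk)
    have "pareto_optimal d n (v \<circ> flip {i. \<mu> i < 0}) (double_star n (B \<union> Q))"
    proof (rule pareto_optimal_double_star[OF n d bounds])
      show "\<mu> i \<noteq> 0" if "i < d" for i using y(1) that by (auto simp: \<mu>_def dk)
      show "B \<union> Q = {w\<in>{2..<n}. 0 < (\<Sum>i<d. star_gap v i w * \<mu> i)}" unfolding f y(2) ..
    qed
    moreover have "{i. \<mu> i < 0} \<in> Pow {1..<d}" by (auto simp: \<mu>_def split: if_splits)
    moreover have "B \<union> Q \<in> Pow {2..<n}" unfolding y(2)[symmetric] by auto
    ultimately show "B \<union> Q \<in> {P \<in> Pow {2..<n}.
        \<exists>g\<in>Pow {1..<d}. pareto_optimal d n (v \<circ> flip g) (double_star n P)}"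
      by blast
  qed
qed

text \<open>The patterns found over all flips strongly shatter each set of size
  \<open>d - 1\<close>, and for one flip distinct patterns give distinct trees. The
  \<open>max 1\<close> covers the case \<open>n - 2 < d - 1\<close>, where the binomial coefficient
  is 0.\<close>

lemma binomial_le_sum_num_pareto:
  assumes n: "2 \<le> n" and d: "0 < d"
    and bounds: "\<And>i e. i < d \<Longrightarrow> e \<in> Kn_edges n \<Longrightarrow>
      edge_level e \<le> v (i, e) \<and> v (i, e) \<le> edge_level e + 1/4"
    and generic: "\<And>m C W. m \<le> d \<Longrightarrow> inj_on C {..<m} \<Longrightarrow> C ` {..<m} \<subseteq> {..<d} \<Longrightarrow>
      inj_on W {..<m} \<Longrightarrow> W ` {..<m} \<subseteq> {2..<n} \<Longrightarrow> Determinant.det (gap_mat v C W m) \<noteq> 0"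
  shows "max 1 ((n - 2) choose (d - 1)) \<le> (\<Sum>g\<in>Pow {1..<d}. num_pareto d n (v \<circ> flip g))"
proof -
  define F where "F g = {P \<in> Pow {2..<n}. pareto_optimal d n (v \<circ> flip g) (double_star n P)}" for g
  let ?F = "{P \<in> Pow {2..<n}. \<exists>g\<in>Pow {1..<d}. pareto_optimal d n (v \<circ> flip g) (double_star n P)}"
  have F_Un: "?F = (\<Union>g\<in>Pow {1..<d}. F g)" by (auto simp: F_def)
  have F_le: "card (F g) \<le> num_pareto d n (v \<circ> flip g)" for g
    unfolding num_pareto_def
  proof (rule card_inj_on_le[of "double_star n"])
    show "inj_on (double_star n) (F g)"
      by (rule inj_on_subset[OF inj_on_double_star]) (auto simp: F_def)
    show "finite {T. pareto_optimal d n (v \<circ> flip g) T}"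
      by (rule finite_subset[OF _ finite_spanning_trees[of n]]) (auto simp: pareto_optimal_def)
  qed (auto simp: F_def)
  have "card ?F \<le> (\<Sum>g\<in>Pow {1..<d}. card (F g))"
    unfolding F_Un by (rule card_UN_le) simp
  also have "\<dots> \<le> (\<Sum>g\<in>Pow {1..<d}. num_pareto d n (v \<circ> flip g))"
    by (intro sum_mono F_le)
  finally have le: "card ?F \<le> (\<Sum>g\<in>Pow {1..<d}. num_pareto d n (v \<circ> flip g))" .
  have "(n - 2) choose (d - 1) = card {S. S \<subseteq> {2..<n} \<and> card S = d - 1}"
    using n_subsets[of "{2..<n}" "d - 1"] by simp
  also have "\<dots> \<le> card {S. S \<subseteq> {2..<n} \<and> strongly_shatters ?F S}"
    using strongly_shatters_pareto[OF n d bounds generic]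
    by (intro card_mono) (auto intro: finite_subset[of _ "Pow {2..<n}"])
  also have "\<dots> \<le> card ?F" by (rule card_strongly_shattered_le) auto
  finally have choose: "(n - 2) choose (d - 1) \<le> card ?F" .
  \<comment> \<open>All weights equal to 1 need no flip and always supply one tree.\<close>
  have "pareto_optimal d n (v \<circ> flip {i. (\<lambda>i. 1::real) i < 0})
      (double_star n {w\<in>{2..<n}. 0 < (\<Sum>i<d. star_gap v i w * (\<lambda>i. 1) i)})"
    by (rule pareto_optimal_double_star[OF n d bounds]) auto
  then have "{w\<in>{2..<n}. 0 < (\<Sum>i<d. star_gap v i w)} \<in> ?F"
    by (auto intro!: bexI[of _ "{}"])
  then have "1 \<le> card ?F"
    by (metis (no_types, lifting) One_nat_def Suc_leI card_gt_0_iff empty_iff finite_Pow_iff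
        finite_atLeastLessThan finite_subset mem_Collect_eq subsetI)
  with choose le show ?thesis by linarith
qed

text \<open>The factor \<open>2 ^ (d - 1)\<close>, the number of flips, cancels the 2 in the
  denominator. What remains is at most the binomial coefficient if \<open>d - 1 \<le> n - 2\<close>,
  and at most 1 otherwise.\<close>

lemma lower_bound_le_binomial:
  assumes "d \<ge> 2" "n \<ge> 3"
  shows "((real n - 3) / (2 * (real d - 1))) ^ (d - 1) * 2 ^ (d - 1)
    \<le> real (max 1 ((n - 2) choose (d - 1)))"
proof -
  define k where "k = d - 1"
  have k: "real d - 1 = real k" "0 < k" using assms by (auto simp: k_def)
  have m: "real n - 3 = real (n - 3)" using assms by simp
  have "((real n - 3) / (2 * (real d - 1))) ^ (d - 1) * 2 ^ (d - 1) = (real (n - 3) / real k) ^ k"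
    unfolding k m k_def[symmetric] power_mult_distrib[symmetric] by simp
  also have "\<dots> \<le> (real (n - 2) / real k) ^ k"
    by (intro power_mono divide_right_mono) auto
  also have "\<dots> \<le> real (max 1 ((n - 2) choose k))"
  proof (cases "k \<le> n - 2")
    case True
    then have "(real (n - 2) / real k) ^ k \<le> real ((n - 2) choose k)"
      by (rule binomial_ge_n_over_k_pow_k)
    then show ?thesis by simp
  next
    case False
    then have "(real (n - 2) / real k) ^ k \<le> 1 ^ k" by (intro power_mono) auto
    then show ?thesis by simp
  qed
  finally show ?thesis by (simp add: k_def)
qed

theorem theorem2:
  fixes d n :: nat
  assumes "d \<ge> 2" and "n \<ge> 3"
  shows "\<exists>\<mu> :: nat \<Rightarrow> nat set \<Rightarrow> real measure.
           (\<forall>i<d. \<forall>e\<in>Kn_edges n. semirandom 4 (\<mu> i e)) \<and>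
           (\<integral>\<^sup>+ v. ennreal (real (num_pareto d n v))
              \<partial>(PiM ({..<d} \<times> Kn_edges n) (\<lambda>(i, e). \<mu> i e)))
             \<ge> ennreal (((real n - 3) / (2 * (real d - 1))) ^ (d - 1))"
proof (intro exI[of _ "\<lambda>i e. quarter_uniform (edge_level e)"] conjI allI impI ballI)
  show "semirandom 4 (quarter_uniform (edge_level e))" for e
    by (rule semirandom_quarter_uniform) (auto simp: edge_level_def)
next
  let ?M = "profit_space d n" and ?N = "max 1 ((n - 2) choose (d - 1))"
  let ?G = "Pow {1..<d}" and ?b = "((real n - 3) / (2 * (real d - 1))) ^ (d - 1)"
  define E where "E = (\<integral>\<^sup>+ v. ennreal (real (num_pareto d n v)) \<partial>?M)"
  interpret prob_space ?M by (rule prob_space_profit_space)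
  have n: "2 \<le> n" and d: "0 < d" using assms by auto
  have "AE v in ?M. ennreal (real ?N) \<le> (\<Sum>g\<in>?G. ennreal (real (num_pareto d n (v \<circ> flip g))))"
    using AE_profit_bounds AE_all_det_gap_mat
  proof eventually_elim
    case (elim v)
    have "?N \<le> (\<Sum>g\<in>?G. num_pareto d n (v \<circ> flip g))"
      by (rule binomial_le_sum_num_pareto[OF n d]) (use elim in blast)+
    then have "ennreal (real ?N) \<le> ennreal (\<Sum>g\<in>?G. real (num_pareto d n (v \<circ> flip g)))"
      unfolding of_nat_sum[symmetric] by (intro ennreal_leI) (simp only: of_nat_le_iff)
    then show ?case by (simp only: sum_ennreal of_nat_0_le_iff)
  qed
  then have "(\<integral>\<^sup>+ v. ennreal (real ?N) \<partial>?M) \<le>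
      (\<integral>\<^sup>+ v. (\<Sum>g\<in>?G. ennreal (real (num_pareto d n (v \<circ> flip g)))) \<partial>?M)"
    by (rule nn_integral_mono_AE)
  also have "\<dots> = (\<Sum>g\<in>?G. \<integral>\<^sup>+ v. ennreal (real (num_pareto d n (v \<circ> flip g))) \<partial>?M)"
    by (rule nn_integral_sum) (rule measurable_num_pareto_flip[OF n])
  \<comment> \<open>By invariance under flips, all \<open>2 ^ (d - 1)\<close> summands equal the
    expectation sought.\<close>
  also have "\<dots> = (\<Sum>g\<in>?G. E)"
    unfolding nn_integral_num_pareto_flip[OF n] E_def ..
  also have "\<dots> = ennreal (2 ^ (d - 1)) * E"
    by (simp add: card_Pow ennreal_power[symmetric])
  finally have "ennreal (real ?N) \<le> ennreal (2 ^ (d - 1)) * E"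
    by (simp add: emeasure_space_1)
  moreover have "ennreal (2 ^ (d - 1)) * ennreal ?b \<le> ennreal (real ?N)"
    using lower_bound_le_binomial[OF assms]
    by (subst ennreal_mult'[symmetric]) (auto intro!: ennreal_leI simp: mult.commute)
  ultimately have "ennreal (2 ^ (d - 1)) * ennreal ?b \<le> ennreal (2 ^ (d - 1)) * E" by (rule order_trans[rotated])
  then have "ennreal ?b \<le> E"
    by (subst (asm) ennreal_mult_le_mult_iff) auto
  then show "ennreal ?b \<le> (\<integral>\<^sup>+ v. ennreal (real (num_pareto d n v))
      \<partial>(PiM ({..<d} \<times> Kn_edges n) (\<lambda>(i, e). quarter_uniform (edge_level e))))"
    by (simp add: E_def profit_space_def)
qed

end
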